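(* Let $S=\{\sigma,\mu\}$, where $\mu,\sigma$ are the morphisms of $\{0,1\}^*$ given by $\mu(0)=01$, $\mu(1)=10$, $\sigma(0)=00$, $\sigma(1)=11$. Then the set of $S$-adic sequences contains uncountably many sequences with pairwise distinct complexity functions.
   Context: A binary sequence is an infinite word $\mathbf{w}\in\{0,1\}^{\mathbb{N}}$. Its complexity function is $n\mapsto|\mathcal{L}^{\mathbf{w}}_n|$, where $\mathcal{L}^{\mathbf{w}}_n$ is the set of factors (contiguous finite subwords) of $\mathbf{w}$ of length $n$. Given a set $S$ of morphisms of $\{0,1\}^*$, a binary sequence $\mathbf{w}$ is $S$-adic if there exist a sequence $(\sigma_n)_{n\ge1}$ with each $\sigma_n\in S$ and a sequence of letters $(a_n)_{n\ge1}$ in $\{0,1\}$ such that $\mathbf{w}=\lim_{n\to\infty}\sigma_1\cdots\sigma_n(a_na_na_n\cdots)$. *)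

theory Defs
  imports "HOL-Analysis.Analysis" "HOL-Library.Z2"
begin

text \<open>
  The alphabet is the two-element type \<^typ>\<open>bit\<close> from \<^theory>\<open>HOL-Library.Z2\<close>; only its two
  elements are used, not its field structure.
\<close>

type_synonym binary_word = "bit list"
type_synonym binary_sequence = "nat \<Rightarrow> bit"

definition factors :: "binary_sequence \<Rightarrow> nat \<Rightarrow> binary_word set" where
  "factors w n = {map w [i..<i + n] | i. True}"

definition complexity :: "binary_sequence \<Rightarrow> nat \<Rightarrow> nat" where
  "complexity w = (\<lambda>n. card (factors w n))"

definition is_morphism :: "(binary_word \<Rightarrow> binary_word) \<Rightarrow> bool" where
  "is_morphism f \<longleftrightarrow> f [] = [] \<and> (\<forall>u v. f (u @ v) = f u @ f v)"

definition morphism_of :: "(bit \<Rightarrow> binary_word) \<Rightarrow> binary_word \<Rightarrow> binary_word" where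
  "morphism_of h u = concat (map h u)"

text \<open>
  The image of an infinite word: letter \<open>k\<close> of the image is read off from the image of any prefix
  that is long enough for its image to have more than \<open>k\<close> letters (for a morphism, all such prefixes
  agree). This is meaningful when such a prefix exists for every \<open>k\<close>, in particular for non-erasing
  morphisms.
\<close>

definition apply_inf :: "(binary_word \<Rightarrow> binary_word) \<Rightarrow> binary_sequence \<Rightarrow> binary_sequence" where
  "apply_inf f w =
     (\<lambda>k. f (map w [0..<(LEAST m. k < length (f (map w [0..<m])))]) ! k)"

text \<open>
  \<open>compose_upto s n\<close> is the composition \<open>s 1 \<circ> \<dots> \<circ> s n\<close>. Directive sequences are indexed from 1,
  so the value of \<open>s\<close> at 0 plays no role.
\<close>

definition compose_upto ::
    "(nat \<Rightarrow> binary_word \<Rightarrow> binary_word) \<Rightarrow> nat \<Rightarrow> binary_word \<Rightarrow> binary_word" where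
  "compose_upto s n = foldr (\<circ>) (map s [1..<Suc n]) id"

text \<open>
  Limits of infinite words are taken in the product of the discrete topologies.
\<close>

definition S_adic :: "(binary_word \<Rightarrow> binary_word) set \<Rightarrow> binary_sequence \<Rightarrow> bool" where
  "S_adic S w \<longleftrightarrow>
     (\<exists>(s :: nat \<Rightarrow> binary_word \<Rightarrow> binary_word) (a :: nat \<Rightarrow> bit).
        (\<forall>n\<ge>1. s n \<in> S) \<and>
        limitin (product_topology (\<lambda>_. discrete_topology UNIV) UNIV)
          (\<lambda>n. apply_inf (compose_upto s n) (\<lambda>_. a n)) w sequentially)"

definition mu_morphism :: "binary_word \<Rightarrow> binary_word" where
  "mu_morphism = morphism_of (\<lambda>b. if b = 0 then [0, 1] else [1, 0])"

definition sigma_morphism :: "binary_word \<Rightarrow> binary_word" where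
  "sigma_morphism = morphism_of (\<lambda>b. if b = 0 then [0, 0] else [1, 1])"

lemma is_morphism_morphism_of: "is_morphism (morphism_of h)"
  by (simp add: is_morphism_def morphism_of_def)

lemma is_morphism_mu: "is_morphism mu_morphism"
  and is_morphism_sigma: "is_morphism sigma_morphism"
  by (simp_all add: mu_morphism_def sigma_morphism_def is_morphism_morphism_of)

lemma mu_morphism_letters: "mu_morphism [0] = [0, 1]" "mu_morphism [1] = [1, 0]"
  and sigma_morphism_letters: "sigma_morphism [0] = [0, 0]" "sigma_morphism [1] = [1, 1]"
  by (simp_all add: mu_morphism_def sigma_morphism_def morphism_of_def)

lemma compose_upto_0: "compose_upto s 0 = id"
  by (simp add: compose_upto_def)

lemma foldr_comp_append: "foldr (\<circ>) fs g = foldr (\<circ>) fs id \<circ> g"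
  by (induction fs) (auto simp: comp_assoc)

lemma compose_upto_Suc: "compose_upto s (Suc n) = compose_upto s n \<circ> s (Suc n)"
  unfolding compose_upto_def using foldr_comp_append[of "map s [1..<Suc n]" "s (Suc n)"] by simp

end

theory Submission
  imports Defs
begin

text \<open>
  Encode a directive sequence by \<open>d\<close>, with \<open>d i = 1\<close> iff the morphism with index \<open>i + 1\<close> is
  \<open>\<mu>\<close>. The limit word has at position \<open>k\<close> the sum modulo 2 of those \<open>d i\<close> for which the binary
  digit \<open>i\<close> of \<open>k\<close> is 1. Its factors of length \<open>m\<close> split into those at even and those at odd
  positions; a word is of both kinds only if it is constant (for \<open>\<sigma>\<close>) or alternating (for \<open>\<mu>\<close>),
  and it then comes from a long run of one letter in the desubstituted word. Counting gives for the
  first difference \<open>s\<^sub>d\<close> of the complexity that \<open>s\<^sub>d (2 n) = s\<^sub>e n\<close>, where \<open>e\<close> is \<open>d\<close> shifted by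
  one, and that \<open>s\<^sub>d 3\<close> is 4 or 2 according as \<open>d 1\<close> is 1 or 0. Hence \<open>s\<^sub>d (3 \<cdot> 2 ^ j)\<close> reveals
  \<open>d (j + 1)\<close>. This needs \<open>d\<close> to take the value 1 infinitely often, which makes the set of factors
  closed under exchanging the letters.
\<close>

text \<open>
  These default rewrite rules turn sums of bits into boolean operations and obstruct additive
  cancellation.
\<close>

declare add_bit_eq_xor [simp del] mult_bit_eq_and [simp del]

lemma bit_add_self [simp]: "a + a = 0" for a :: bit
  by (cases a) simp_all

lemma bit_add_cancel [simp]: "a + c + c = a" for a c :: bit
  by (simp add: add.assoc)

lemma UNIV_bit: "(UNIV :: bit set) = {0, 1}"
  by auto

section \<open>Digit-sum words and the exchange of letters\<close>

text \<open>The image of \<open>x\<close> under \<sigma> if \<open>c = 0\<close> and under \<mu> if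
  \<open>c = 1\<close>: a letter \<open>a\<close> becomes the block \<open>a\<close>,
  \<open>a + c\<close>.\<close>

definition dbl :: "bit \<Rightarrow> binary_sequence \<Rightarrow> binary_sequence" where
  "dbl c x k = x (k div 2) + of_bool (odd k) * c"

text \<open>For \<open>d\<close> constantly 1 this is the Thue-Morse word.\<close>

fun digit_sum :: "(nat \<Rightarrow> bit) \<Rightarrow> binary_sequence" where
  "digit_sum d k =
     (if k = 0 then 0 else digit_sum (\<lambda>i. d (Suc i)) (k div 2) + of_bool (odd k) * d 0)"

declare digit_sum.simps [simp del]

lemma digit_sum_0 [simp]: "digit_sum d 0 = 0"
  by (simp add: digit_sum.simps)

lemma digit_sum_dbl: "digit_sum d = dbl (d 0) (digit_sum (\<lambda>i. d (Suc i)))"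
proof
  show "digit_sum d k = dbl (d 0) (digit_sum (\<lambda>i. d (Suc i))) k" for k
    by (cases "k = 0") (simp_all add: dbl_def digit_sum.simps [of d k])
qed

lemma dbl_even [simp]: "dbl c x (2 * k) = x k"
  and dbl_odd [simp]: "dbl c x (Suc (2 * k)) = x k + c"
  by (simp_all add: dbl_def)

lemma dbl_odd_add: "dbl c x (Suc (2 * i + t)) = x (i + Suc t div 2) + of_bool (even t) * c"
proof -
  have "Suc (2 * i + t) = 2 * i + Suc t"
    by simp
  then show ?thesis
    unfolding dbl_def by (simp only: div_mult_self4 even_add even_Suc) simp
qed

definition flip_closed :: "binary_sequence \<Rightarrow> bool" where
  "flip_closed x \<longleftrightarrow> (\<forall>i n. \<exists>j. \<forall>t<n. x (j + t) = x (i + t) + 1)"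

text \<open>Adding \<open>2 ^ m\<close> sets the digit at place \<open>m\<close>, which is 0 in
  \<open>k\<close>; the induction strips the lowest digit together with \<open>d 0\<close>.\<close>

lemma digit_sum_add_power:
  assumes "k < 2 ^ m"
  shows "digit_sum d (k + 2 ^ m) = digit_sum d k + d m"
  using assms
proof (induction m arbitrary: d k)
  case 0
  then show ?case
    by (simp add: digit_sum.simps [of d "Suc 0"])
next
  case (Suc m)
  have "k div 2 < 2 ^ m" and "(k + 2 ^ Suc m) div 2 = k div 2 + 2 ^ m"
    using Suc.prems by simp_all
  then show ?case
    using Suc.IH [of "k div 2" "\<lambda>i. d (Suc i)"]
    by (simp add: digit_sum_dbl [of d] dbl_def add_ac)
qed

lemma flip_closed_digit_sum:
  assumes "\<exists>\<^sub>\<infinity>m. d m = 1"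
  shows "flip_closed (digit_sum d)"
  unfolding flip_closed_def
proof (intro allI)
  fix i n
  \<comment> \<open>The window lies below \<open>2 ^ m\<close>, so shifting it by
    \<open>2 ^ m\<close> adds \<open>d m = 1\<close> to each letter.\<close>
  obtain m where m: "i + n \<le> m" "d m = 1"
    using assms by (auto simp: INFM_nat_le)
  have "digit_sum d (i + 2 ^ m + t) = digit_sum d (i + t) + 1" if "t < n" for t
  proof -
    have "i + t < 2 ^ m"
      using that m(1) less_exp [of m] by linarith
    then show ?thesis
      using digit_sum_add_power [of "i + t" m d] m(2) by (simp add: add_ac)
  qed
  then show "\<exists>j. \<forall>t<n. digit_sum d (j + t) = digit_sum d (i + t) + 1"
    by blast
qed

section \<open>Windows, factors and runs\<close>

lemma window_eq_iff:
  "map w [i..<i + n] = map w [j..<j + n] \<longleftrightarrow> (\<forall>t<n. w (i + t) = w (j + t))"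
  by (auto simp: list_eq_iff_nth_eq)

lemma window_eq_map_iff:
  "map w [i..<i + n] = map f [0..<n] \<longleftrightarrow> (\<forall>t<n. w (i + t) = f t)"
  by (auto simp: list_eq_iff_nth_eq)

lemma factors_eq_range: "factors w n = range (\<lambda>i. map w [i..<i + n])"
  by (auto simp: factors_def)

lemma finite_factors: "finite (factors w n)"
proof (rule finite_subset)
  have "finite (UNIV :: bit set)"
    by (simp add: UNIV_bit)
  then show "finite {xs :: bit list. set xs \<subseteq> UNIV \<and> length xs = n}"
    by (rule finite_lists_length_eq)
qed (auto simp: factors_def)

text \<open>Both ranges are in bijection with the classes of one partition of the indices. Factors
  can thus be counted by comparing start positions.\<close>

lemma card_range_eq:
  assumes "\<And>i j. f i = f j \<longleftrightarrow> g i = g j"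
  shows "card (range f) = card (range g)"
proof (rule bij_betw_same_card)
  show "bij_betw (\<lambda>y. g (inv f y)) (range f) (range g)"
    unfolding bij_betw_def
  proof
    show "inj_on (\<lambda>y. g (inv f y)) (range f)"
      by (rule inj_onI) (metis assms f_inv_into_f)
    have "g (inv f (f i)) = g i" for i
      by (metis assms f_inv_into_f rangeI)
    then show "(\<lambda>y. g (inv f y)) ` range f = range g"
      by (simp add: image_image)
  qed
qed

definition runs :: "binary_sequence \<Rightarrow> nat \<Rightarrow> bit set" where
  "runs x n = {a. \<exists>i. \<forall>t<n. x (i + t) = a}"

lemma runs_flip:
  assumes "flip_closed x" "a \<in> runs x n"
  shows "a + c \<in> runs x n"
proof (cases "c = 0")
  case False
  then have "c = 1"
    by simp
  obtain i where i: "\<forall>t<n. x (i + t) = a"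
    using assms(2) by (auto simp: runs_def)
  obtain j where "\<forall>t<n. x (j + t) = x (i + t) + 1"
    using assms(1) unfolding flip_closed_def by blast
  with i \<open>c = 1\<close> show ?thesis
    by (auto simp: runs_def)
qed (use assms in simp)

section \<open>Counting the factors of a doubled word by parity of position\<close>

text \<open>An even window meets \<open>(m + 1) div 2\<close> blocks, each from its first letter on,
  and that letter determines the block.\<close>

lemma card_even_windows:
  "card (range (\<lambda>i. map (dbl c x) [2 * i..<2 * i + m])) = complexity x ((m + 1) div 2)"
  unfolding complexity_def factors_eq_range
proof (rule card_range_eq, unfold window_eq_iff)
  fix i j
  show "(\<forall>t<m. dbl c x (2 * i + t) = dbl c x (2 * j + t)) \<longleftrightarrow>
        (\<forall>t<(m + 1) div 2. x (i + t) = x (j + t))" (is "?L \<longleftrightarrow> ?R")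
  proof
    assume ?L
    show ?R
    proof (intro allI impI)
      fix t assume "t < (m + 1) div 2"
      then have "2 * t < m" by linarith
      with \<open>?L\<close> have "dbl c x (2 * i + 2 * t) = dbl c x (2 * j + 2 * t)"
        by blast
      then show "x (i + t) = x (j + t)"
        by (simp add: dbl_def)
    qed
  next
    assume ?R
    show ?L
    proof (intro allI impI)
      fix t assume "t < m"
      then have "t div 2 < (m + 1) div 2" by linarith
      with \<open>?R\<close> have "x (i + t div 2) = x (j + t div 2)"
        by blast
      then show "dbl c x (2 * i + t) = dbl c x (2 * j + t)"
        by (simp add: dbl_def)
    qed
  qed
qed

text \<open>An odd window opens with the second half of a block, so for even \<open>m\<close> it
  meets one block more. The letter behind that half block is recovered by cancelling
  \<open>c\<close>.\<close>

lemma card_odd_windows: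
  assumes "m \<ge> 1"
  shows "card (range (\<lambda>i. map (dbl c x) [2 * i + 1..<2 * i + 1 + m])) = complexity x (m div 2 + 1)"
  unfolding complexity_def factors_eq_range
proof (rule card_range_eq, unfold window_eq_iff)
  fix i j
  show "(\<forall>t<m. dbl c x (2 * i + 1 + t) = dbl c x (2 * j + 1 + t)) \<longleftrightarrow>
        (\<forall>t<m div 2 + 1. x (i + t) = x (j + t))" (is "?L \<longleftrightarrow> ?R")
  proof
    assume ?L
    show ?R
    proof (intro allI impI)
      fix t assume t: "t < m div 2 + 1"
      show "x (i + t) = x (j + t)"
      proof (cases t)
        case 0
        then show ?thesis
          using \<open>?L\<close> assms by (auto dest!: spec [of _ 0] simp: dbl_def)
      next
        case (Suc s)
        with t have "2 * s + 1 < m" by linarith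
        with \<open>?L\<close> have "dbl c x (2 * i + 1 + (2 * s + 1)) = dbl c x (2 * j + 1 + (2 * s + 1))"
          by blast
        then show ?thesis
          using Suc by (simp add: dbl_def)
      qed
    qed
  next
    assume ?R
    show ?L
    proof (intro allI impI)
      fix t assume "t < m"
      then have "(t + 1) div 2 < m div 2 + 1" by linarith
      with \<open>?R\<close> have "x (i + (t + 1) div 2) = x (j + (t + 1) div 2)"
        by blast
      then show "dbl c x (2 * i + 1 + t) = dbl c x (2 * j + 1 + t)"
        by (simp add: dbl_odd_add)
    qed
  qed
qed

text \<open>In a word seen at both parities, the even occurrence forces a step of \<open>c\<close>
  after even offsets and the odd one after odd offsets. So its first letter fixes the word, and the
  odd occurrence comes from a run.\<close>

lemma parity_ambiguous_windows:
  assumes "flip_closed x" "m \<ge> 1"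
  shows "range (\<lambda>i. map (dbl c x) [2 * i..<2 * i + m]) \<inter>
         range (\<lambda>i. map (dbl c x) [2 * i + 1..<2 * i + 1 + m]) =
         (\<lambda>a. map (\<lambda>t. a + of_bool (odd t) * c) [0..<m]) ` runs x (m div 2 + 1)"
    (is "?A \<inter> ?B = ?f ` ?T")
proof (intro equalityI subsetI)
  fix v assume "v \<in> ?A \<inter> ?B"
  then obtain i j where i: "v = map (dbl c x) [2 * i..<2 * i + m]"
    and j: "v = map (dbl c x) [2 * j + 1..<2 * j + 1 + m]"
    by blast
  have eq: "dbl c x (2 * i + t) = dbl c x (2 * j + 1 + t)" if "t < m" for t
    using i j that window_eq_iff by metis
  have alt: "dbl c x (2 * i + t) = x i + of_bool (odd t) * c" if "t < m" for t
    using that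
  proof (induction t)
    case 0
    then show ?case by simp
  next
    case (Suc t)
    show ?case
    proof (cases "even t")
      case True
      then have "dbl c x (2 * i + Suc t) = dbl c x (2 * i + t) + c"
        by (simp add: dbl_def)
      then show ?thesis
        using True Suc by simp
    next
      case False
      have "dbl c x (2 * i + Suc t) = dbl c x (2 * j + 1 + Suc t)"
        using eq Suc.prems by blast
      also have "\<dots> = dbl c x (2 * j + 1 + t) + c"
        using False by (simp add: dbl_def)
      also have "\<dots> = dbl c x (2 * i + t) + c"
        using eq Suc by simp
      finally show ?thesis
        using False Suc by (simp add: add.assoc)
    qed
  qed
  have "x (j + u) = x i + c" if "u < m div 2 + 1" for u
  proof (cases u)
    case 0
    then show ?thesis
      using eq [of 0] assms(2) by (simp add: add.assoc)
  next
    case (Suc s)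
    with that have "2 * s + 1 < m" by linarith
    then show ?thesis
      using eq [of "2 * s + 1"] alt [of "2 * s + 1"] Suc by (simp add: dbl_def)
  qed
  then have "x i + c \<in> ?T"
    by (auto simp: runs_def)
  \<comment> \<open>The odd occurrence yields a run of \<open>x i + c\<close>, while the word is
    labelled by \<open>x i\<close>; exchanging letters bridges the gap.\<close>
  then have "x i + c + c \<in> ?T"
    using assms(1) runs_flip by blast
  then have "x i \<in> ?T"
    by (simp add: add.assoc)
  moreover have "v = ?f (x i)"
    unfolding i window_eq_map_iff using alt by blast
  ultimately show "v \<in> ?f ` ?T"
    by blast
next
  fix v assume "v \<in> ?f ` ?T"
  then obtain a where v: "v = ?f a" and a: "a \<in> ?T"
    by blast
  obtain i where i: "\<And>t. t < m div 2 + 1 \<Longrightarrow> x (i + t) = a"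
    using a by (auto simp: runs_def)
  \<comment> \<open>An odd window opens with the second letter of a block, so the run needed there
    is one of \<open>a + c\<close>.\<close>
  obtain j where j: "\<And>t. t < m div 2 + 1 \<Longrightarrow> x (j + t) = a + c"
    using runs_flip [OF assms(1) a, of c] by (auto simp: runs_def)
  have "dbl c x (2 * i + t) = a + of_bool (odd t) * c" if "t < m" for t
  proof -
    have "t div 2 < m div 2 + 1" using that by linarith
    then show ?thesis using i by (simp add: dbl_def)
  qed
  then have "map (dbl c x) [2 * i..<2 * i + m] = v"
    unfolding v window_eq_map_iff by blast
  moreover have "dbl c x (2 * j + 1 + t) = a + of_bool (odd t) * c" if "t < m" for t
  proof -
    have "(t + 1) div 2 < m div 2 + 1" using that by linarith
    then have "x (j + (t + 1) div 2) = a + c" using j by blast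
    then show ?thesis by (simp add: dbl_odd_add)
  qed
  then have "map (dbl c x) [2 * j + 1..<2 * j + 1 + m] = v"
    unfolding v window_eq_map_iff by blast
  ultimately show "v \<in> ?A \<inter> ?B"
    by - (intro IntI; (rule range_eqI, rule sym, assumption))
qed

text \<open>Inclusion-exclusion over the parity of the start position, in additive form to avoid
  truncated subtraction.\<close>

lemma complexity_dbl:
  assumes "flip_closed x" "m \<ge> 1"
  shows "complexity (dbl c x) m + card (runs x (m div 2 + 1)) =
         complexity x ((m + 1) div 2) + complexity x (m div 2 + 1)"
proof -
  let ?A = "range (\<lambda>i. map (dbl c x) [2 * i..<2 * i + m])"
  let ?B = "range (\<lambda>i. map (dbl c x) [2 * i + 1..<2 * i + 1 + m])"
  have un: "factors (dbl c x) m = ?A \<union> ?B"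
  proof -
    have "UNIV = range (\<lambda>i. 2 * i) \<union> range (\<lambda>i::nat. 2 * i + 1)"
    proof (intro UNIV_eq_I)
      show "k \<in> range (\<lambda>i. 2 * i) \<union> range (\<lambda>i. 2 * i + 1)" for k :: nat
        by (cases "even k") (auto elim!: evenE oddE)
    qed
    then have "factors (dbl c x) m =
        (\<lambda>i. map (dbl c x) [i..<i + m]) ` (range (\<lambda>i. 2 * i) \<union> range (\<lambda>i. 2 * i + 1))"
      by (simp add: factors_eq_range)
    then show ?thesis
      by (simp add: image_Un image_image)
  qed
  have "inj_on (\<lambda>a. map (\<lambda>t. a + of_bool (odd t) * c) [0..<m]) (runs x (m div 2 + 1))"
    using assms(2) by (intro inj_onI) (force simp: list_eq_iff_nth_eq)
  then have "card (?A \<inter> ?B) = card (runs x (m div 2 + 1))"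
    by (simp only: parity_ambiguous_windows [OF assms] card_image)
  moreover have "card ?A + card ?B = card (?A \<union> ?B) + card (?A \<inter> ?B)"
    using finite_factors [of "dbl c x" m] by (intro card_Un_Int) (simp_all add: un)
  ultimately show ?thesis
    using card_even_windows [of c x m] card_odd_windows [OF assms(2), of c x]
    by (simp add: complexity_def [of "dbl c x"] un)
qed

section \<open>First differences of the complexity\<close>

definition growth :: "binary_sequence \<Rightarrow> nat \<Rightarrow> int" where
  "growth x n = int (complexity x (n + 1)) - int (complexity x n)"

text \<open>Lengths \<open>2 * n\<close> and \<open>2 * n + 1\<close> have the same run term, which
  cancels.\<close>

lemma growth_dbl_even:
  assumes "flip_closed x" "n \<ge> 1"
  shows "growth (dbl c x) (2 * n) = growth x n"
  using complexity_dbl [OF assms(1), of "2 * n" c] complexity_dbl [OF assms(1), of "2 * n + 1" c]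
    assms(2)
  by (simp add: growth_def)

text \<open>Here the run lengths differ, \<open>n + 1\<close> against \<open>n + 2\<close>; this
  difference is what detects a morphism.\<close>

lemma growth_dbl_odd:
  assumes "flip_closed x"
  shows "growth (dbl c x) (2 * n + 1) =
         growth x (n + 1) + int (card (runs x (n + 1))) - int (card (runs x (n + 2)))"
  using complexity_dbl [OF assms, of "2 * n + 1" c] complexity_dbl [OF assms, of "2 * n + 2" c]
  by (simp add: growth_def)

lemma INFM_shift:
  assumes "\<exists>\<^sub>\<infinity>m. d m = (1 :: bit)"
  shows "\<exists>\<^sub>\<infinity>m. d (Suc m) = 1"
  unfolding INFM_nat_le
proof
  fix N
  obtain m where "m \<ge> Suc N" "d m = 1"
    using assms by (auto simp: INFM_nat_le)
  then show "\<exists>n\<ge>N. d (Suc n) = 1"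
    by (intro exI [of _ "m - 1"]) auto
qed

section \<open>Short factors and runs of digit-sum words\<close>

lemma digit_sum_step_neq:
  assumes "\<exists>\<^sub>\<infinity>m. d m = 1"
  obtains k where "digit_sum d (Suc k) = digit_sum d k + 1"
proof -
  have "\<exists>k. digit_sum d (Suc k) \<noteq> digit_sum d k"
  proof (rule ccontr)
    assume "\<not> ?thesis"
    then have "digit_sum d k = 0" for k
      by (induction k) simp_all
    moreover obtain m where "d m = 1"
      using assms by (auto simp: INFM_nat_le)
    \<comment> \<open>The letter at position \<open>2 ^ m\<close> is \<open>d m = 1\<close>.\<close>
    ultimately show False
      using digit_sum_add_power [of 0 m d] by simp
  qed
  then obtain k where "digit_sum d (Suc k) \<noteq> digit_sum d k"
    by blast
  then have "digit_sum d (Suc k) = digit_sum d k + 1"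
    by (cases "digit_sum d (Suc k)"; cases "digit_sum d k") simp_all
  then show thesis
    by (rule that)
qed

text \<open>If \<open>d 0 = 1\<close>, a change of letter in the desubstituted word gives equal
  letters across a block boundary.\<close>

lemma digit_sum_step_eq:
  assumes "\<exists>\<^sub>\<infinity>m. d m = 1"
  obtains k where "digit_sum d (Suc k) = digit_sum d k"
proof (cases "d 0 = 0")
  case True
  then have "digit_sum d (Suc 0) = digit_sum d 0"
    by (simp add: digit_sum_dbl [of d] dbl_def)
  then show thesis
    by (rule that)
next
  case False
  obtain k where "digit_sum (\<lambda>i. d (Suc i)) (Suc k) = digit_sum (\<lambda>i. d (Suc i)) k + 1"
    using digit_sum_step_neq [OF INFM_shift [OF assms]] .
  then have "digit_sum d (Suc (Suc (2 * k))) = digit_sum d (Suc (2 * k))"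
    using False by (simp add: digit_sum_dbl [of d] dbl_def)
  then show thesis
    by (rule that)
qed

lemma runs_eq_UNIV:
  assumes "flip_closed x" "\<forall>t<n. x (i + t) = a"
  shows "runs x n = UNIV"
proof -
  have "a \<in> runs x n"
    using assms(2) by (auto simp: runs_def)
  then have "a + (a + b) \<in> runs x n" for b
    using runs_flip [OF assms(1)] by blast
  then show ?thesis
    by (auto simp flip: add.assoc)
qed

lemma runs_digit_sum_2:
  assumes "\<exists>\<^sub>\<infinity>m. d m = 1"
  shows "runs (digit_sum d) 2 = UNIV"
proof -
  obtain k where "digit_sum d (Suc k) = digit_sum d k"
    using digit_sum_step_eq [OF assms] .
  then show ?thesis
    by (intro runs_eq_UNIV [OF flip_closed_digit_sum [OF assms], where i = k])
       (auto simp: less_2_cases_iff)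
qed

text \<open>If \<open>d 0 = 1\<close>, three consecutive letters contain a block of two distinct
  letters; otherwise two equal letters are doubled to four.\<close>

lemma runs_digit_sum_3:
  assumes "\<exists>\<^sub>\<infinity>m. d m = 1"
  shows "runs (digit_sum d) 3 = (if d 0 = 1 then {} else UNIV)"
proof (cases "d 0 = 1")
  case True
  have "\<not> (\<forall>t<3. digit_sum d (i + t) = a)" for i a
  proof
    assume "\<forall>t<3. digit_sum d (i + t) = a"
    then have *: "digit_sum d i = digit_sum d (Suc i)" "digit_sum d (Suc i) = digit_sum d (Suc (Suc i))"
      by (auto simp: eval_nat_numeral less_Suc_eq)
    show False
    proof (cases "even i")
      case True
      then show ?thesis
        using *(1) \<open>d 0 = 1\<close> by (simp add: digit_sum_dbl [of d] dbl_def)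
    next
      case False
      then show ?thesis
        using *(2) \<open>d 0 = 1\<close> by (simp add: digit_sum_dbl [of d] dbl_def)
    qed
  qed
  then show ?thesis
    using True by (auto simp: runs_def)
next
  case False
  obtain k where k: "digit_sum (\<lambda>i. d (Suc i)) (Suc k) = digit_sum (\<lambda>i. d (Suc i)) k"
    using digit_sum_step_eq [OF INFM_shift [OF assms]] .
  have "digit_sum d (2 * k + t) = digit_sum (\<lambda>i. d (Suc i)) k" if "t < 3" for t
  proof -
    have "t = 0 \<or> t = 1 \<or> t = 2"
      using that by linarith
    then show ?thesis
      using False k by (auto simp: digit_sum_dbl [of d] dbl_def)
  qed
  then show ?thesis
    using False runs_eq_UNIV [OF flip_closed_digit_sum [OF assms]] by metis
qed

lemma complexity_digit_sum_1:
  assumes "\<exists>\<^sub>\<infinity>m. d m = 1"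
  shows "complexity (digit_sum d) 1 = 2"
proof -
  have "[a] \<in> factors (digit_sum d) 1" for a
  proof -
    obtain i where "\<forall>t<2. digit_sum d (i + t) = a"
      using runs_digit_sum_2 [OF assms] by (force simp: runs_def set_eq_iff)
    then show ?thesis
      by (auto simp: factors_def dest: spec [of _ 0] intro!: exI [of _ i])
  qed
  then have "factors (digit_sum d) 1 = range (\<lambda>a. [a])"
    by (auto simp: factors_def)
  then show ?thesis
    by (simp add: complexity_def UNIV_bit)
qed

lemma complexity_digit_sum_2:
  assumes "\<exists>\<^sub>\<infinity>m. d m = 1"
  shows "complexity (digit_sum d) 2 = 4"
proof -
  let ?w = "digit_sum d"
  have two: "map ?w [i..<i + 2] = [?w i, ?w (Suc i)]" for i
    by (simp add: upt_rec)
  \<comment> \<open>Equal pairs come from runs, unequal ones from a change of letter or its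
    exchanged copy.\<close>
  have ex: "\<exists>i. ?w i = a \<and> ?w (Suc i) = b" for a b
  proof (cases "a = b")
    case True
    obtain i where "\<forall>t<2. ?w (i + t) = a"
      using runs_digit_sum_2 [OF assms] by (force simp: runs_def set_eq_iff)
    then show ?thesis
      using True by (auto dest: spec [of _ 0] spec [of _ 1] intro!: exI [of _ i])
  next
    case False
    then have b: "b = a + 1"
      by (cases a; cases b) simp_all
    obtain k where k: "?w (Suc k) = ?w k + 1"
      using digit_sum_step_neq [OF assms] .
    obtain j where "\<forall>t<2. ?w (j + t) = ?w (k + t) + 1"
      using flip_closed_digit_sum [OF assms] unfolding flip_closed_def by blast
    then have j: "?w j = ?w k + 1" "?w (Suc j) = ?w k"
      using k by (auto dest: spec [of _ 0] spec [of _ 1])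
    show ?thesis
    proof (cases "?w k = a")
      case True
      then show ?thesis using k b by auto
    next
      case False
      then have "?w k = a + 1"
        by (cases a; cases "?w k") simp_all
      then show ?thesis using j b by auto
    qed
  qed
  have "[a, b] \<in> factors ?w 2" for a b
  proof -
    obtain i where "?w i = a" "?w (Suc i) = b"
      using ex by blast
    then have "[a, b] = [?w i, ?w (Suc i)]"
      by simp
    then show ?thesis
      unfolding factors_eq_range two by (rule range_eqI)
  qed
  then have "factors ?w 2 = (\<lambda>(a, b). [a, b]) ` (UNIV \<times> UNIV)"
    unfolding factors_eq_range two by auto
  then show ?thesis
    by (simp add: complexity_def UNIV_bit)
qed

section \<open>Reading the directive sequence off the complexity\<close>

text \<open>The odd recursion at \<open>n = 1\<close> starts from growth 4 - 2 = 2. In the word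
  desubstituted once, runs of length 2 add 2, and runs of length 3 subtract 0 or 2 as
  \<open>d 1\<close> is 1 or 0.\<close>

lemma growth_digit_sum_3:
  assumes "\<exists>\<^sub>\<infinity>m. d m = 1"
  shows "growth (digit_sum d) 3 = (if d 1 = 1 then 4 else 2)"
proof -
  let ?d1 = "\<lambda>i. d (Suc i)" and ?d2 = "\<lambda>i. d (Suc (Suc i))"
  have 1: "\<exists>\<^sub>\<infinity>m. ?d1 m = 1"
    using assms by (rule INFM_shift)
  then have 2: "\<exists>\<^sub>\<infinity>m. ?d2 m = 1"
    by (rule INFM_shift)
  have "growth (digit_sum ?d1) 2 = growth (digit_sum ?d2) 1"
    using growth_dbl_even [OF flip_closed_digit_sum [OF 2], of 1]
    by (simp add: digit_sum_dbl [of ?d1])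
  also have "\<dots> = 2"
    using complexity_digit_sum_1 [OF 2] complexity_digit_sum_2 [OF 2]
    by (simp add: growth_def flip: Suc_1)
  finally have "growth (digit_sum ?d1) 2 = 2" .
  moreover have "growth (digit_sum d) 3 = growth (digit_sum ?d1) 2
      + int (card (runs (digit_sum ?d1) 2)) - int (card (runs (digit_sum ?d1) 3))"
    using growth_dbl_odd [OF flip_closed_digit_sum [OF 1], of "d 0" 1]
    by (simp add: eval_nat_numeral flip: digit_sum_dbl)
  ultimately show ?thesis
    by (simp add: runs_digit_sum_2 [OF 1] runs_digit_sum_3 [OF 1] UNIV_bit)
qed

lemma growth_digit_sum:
  assumes "\<exists>\<^sub>\<infinity>m. d m = 1"
  shows "growth (digit_sum d) (3 * 2 ^ j) = (if d (Suc j) = 1 then 4 else 2)"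
  using assms
proof (induction j arbitrary: d)
  case 0
  then show ?case
    using growth_digit_sum_3 by simp
next
  case (Suc j)
  have "growth (digit_sum d) (2 * (3 * 2 ^ j)) = growth (digit_sum (\<lambda>i. d (Suc i))) (3 * 2 ^ j)"
    unfolding digit_sum_dbl [of d]
    by (intro growth_dbl_even flip_closed_digit_sum INFM_shift Suc.prems) simp
  then show ?case
    using Suc.IH [OF INFM_shift [OF Suc.prems]] by (simp add: mult.left_commute)
qed

section \<open>Digit-sum words as S-adic limits\<close>

text \<open>Directive sequences start at index 1 and \<open>d\<close> at 0, hence
  \<open>n - 1\<close>.\<close>

definition directive :: "(nat \<Rightarrow> bit) \<Rightarrow> nat \<Rightarrow> binary_word \<Rightarrow> binary_word" where
  "directive d n = (if d (n - 1) = 0 then sigma_morphism else mu_morphism)"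

lemma morphism_window_dbl:
  "(if c = 0 then sigma_morphism else mu_morphism) (map x [0..<m]) = map (dbl c x) [0..<2 * m]"
proof (induction m)
  case (Suc m)
  have "(if c = 0 then sigma_morphism else mu_morphism) (map x [0..<Suc m]) =
      map (dbl c x) [0..<2 * m] @ [x m, x m + c]"
    using Suc by (cases c; cases "x m")
      (simp_all add: sigma_morphism_def mu_morphism_def morphism_of_def)
  then show ?case
    by simp
qed (simp add: sigma_morphism_def mu_morphism_def morphism_of_def)

text \<open>The quotient by \<open>2 ^ n\<close> names the letter of \<open>x\<close>, the remainder
  the offset in its image. In the induction the innermost morphism acts on \<open>x\<close> first,
  and digit \<open>n\<close> of \<open>k\<close> moves from quotient to remainder.\<close>

lemma compose_directive_window:
  "compose_upto (directive d) n (map x [0..<m]) =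
   map (\<lambda>k. x (k div 2 ^ n) + digit_sum d (k mod 2 ^ n)) [0..<m * 2 ^ n]"
proof (induction n arbitrary: x m)
  case 0
  then show ?case
    by (simp add: compose_upto_0)
next
  case (Suc n)
  have "dbl (d n) x (k div 2 ^ n) + digit_sum d (k mod 2 ^ n) =
        x (k div 2 ^ Suc n) + digit_sum d (k mod 2 ^ Suc n)" for k
  proof -
    have "k mod 2 ^ Suc n = k mod 2 ^ n + of_bool (odd (k div 2 ^ n)) * 2 ^ n"
      using mod_mult2_eq [of k "2 ^ n" 2] by (simp add: mult.commute mod_2_eq_odd)
    then have "digit_sum d (k mod 2 ^ Suc n) =
        digit_sum d (k mod 2 ^ n) + of_bool (odd (k div 2 ^ n)) * d n"
      using digit_sum_add_power [of "k mod 2 ^ n" n d] by simp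
    moreover have "k div 2 ^ Suc n = k div 2 ^ n div 2"
      by (simp only: power_Suc2 div_mult2_eq)
    ultimately show ?thesis
      unfolding dbl_def by (simp only: add_ac)
  qed
  then show ?case
    using Suc.IH [of "dbl (d n) x" "2 * m"] morphism_window_dbl [of "d n" x m]
    by (simp add: compose_upto_Suc directive_def mult_ac)
qed

lemma apply_inf_window:
  assumes "\<And>m. f (map x [0..<m]) = map y [0..<m * p]" "p > 0"
  shows "apply_inf f x = y"
proof
  fix k
  \<comment> \<open>A witness that the \<open>LEAST\<close> in \<open>apply_inf\<close> is
    attained.\<close>
  have "k < length (f (map x [0..<Suc k]))"
    unfolding assms(1) using assms(2) mult_le_mono2 [of 1 p "Suc k"] by simp
  then have "k < length (f (map x [0..<(LEAST m. k < length (f (map x [0..<m])))]))"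
    by (rule LeastI)
  then show "apply_inf f x k = y k"
    by (simp add: apply_inf_def assms)
qed

lemma S_adic_digit_sum: "S_adic {sigma_morphism, mu_morphism} (digit_sum d)"
  unfolding S_adic_def
proof (intro exI conjI)
  show "\<forall>n\<ge>1. directive d n \<in> {sigma_morphism, mu_morphism}"
    by (simp add: directive_def)
  \<comment> \<open>With all letters 0 the approximant has period \<open>2 ^ n\<close> and agrees
    with the limit below \<open>2 ^ n\<close>.\<close>
  have lim: "apply_inf (compose_upto (directive d) n) (\<lambda>_. 0) = (\<lambda>k. digit_sum d (k mod 2 ^ n))" for n
    using apply_inf_window [OF compose_directive_window [of d n "\<lambda>_. 0"]] by simp
  have ev: "\<forall>\<^sub>F n in sequentially. digit_sum d (k mod 2 ^ n) = digit_sum d k" for k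
  proof (rule eventually_sequentiallyI)
    fix n assume "k \<le> n"
    then have "k < 2 ^ n"
      using less_exp [of n] by linarith
    then show "digit_sum d (k mod 2 ^ n) = digit_sum d k"
      by simp
  qed
  have "\<forall>\<^sub>F n in sequentially. digit_sum d (k mod 2 ^ n) \<in> U" if "digit_sum d k \<in> U" for k U
    by (rule eventually_mono [OF ev [of k]]) (simp add: that)
  then have "limitin (discrete_topology UNIV) (\<lambda>n. digit_sum d (k mod 2 ^ n)) (digit_sum d k) sequentially" for k
    unfolding limitin_def by simp
  then show "limitin (product_topology (\<lambda>_. discrete_topology UNIV) UNIV)
      (\<lambda>n. apply_inf (compose_upto (directive d) n) (\<lambda>_. 0)) (digit_sum d) sequentially"
    unfolding limitin_componentwise lim by simp
qed

theorem theorem9p1: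
  shows "\<exists>W :: binary_sequence set.
           W \<subseteq> {w. S_adic {sigma_morphism, mu_morphism} w} \<and>
           uncountable W \<and>
           inj_on complexity W"
proof (intro exI conjI)
  \<comment> \<open>Even places supply infinitely many ones; the odd place \<open>2 * i + 1\<close>
    records whether \<open>i \<in> A\<close>.\<close>
  define d :: "nat set \<Rightarrow> nat \<Rightarrow> bit" where
    "d A i = of_bool (even i \<or> i div 2 \<in> A)" for A i
  let ?w = "\<lambda>A. digit_sum (d A)"
  have ones: "\<exists>\<^sub>\<infinity>m. d A m = 1" for A
    unfolding INFM_nat_le
  proof
    show "\<exists>n\<ge>N. d A n = 1" for N
      by (intro exI [of _ "2 * N"]) (simp add: d_def)
  qed
  have "A = B" if "complexity (?w A) = complexity (?w B)" for A B
  proof (rule set_eqI)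
    fix i
    \<comment> \<open>This length tests place \<open>2 * i + 1\<close>.\<close>
    have "growth (?w A) (3 * 2 ^ (2 * i)) = growth (?w B) (3 * 2 ^ (2 * i))"
      using that by (simp add: growth_def)
    then have "d A (Suc (2 * i)) = 1 \<longleftrightarrow> d B (Suc (2 * i)) = 1"
      by (simp add: growth_digit_sum [OF ones] split: if_splits)
    then show "i \<in> A \<longleftrightarrow> i \<in> B"
      by (simp add: d_def)
  qed
  then have inj: "inj (\<lambda>A. complexity (?w A))"
    by (rule injI)
  show "inj_on complexity (range ?w)"
    using inj by (auto simp: inj_on_def)
  have "inj ?w"
    using inj by (auto simp: inj_on_def)
  moreover have "uncountable (UNIV :: nat set set)"
  proof
    assume "countable (UNIV :: nat set set)"
    then have "range (from_nat_into (UNIV :: nat set set)) = UNIV"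
      by (rule range_from_nat_into [rotated]) simp
    then show False
      using Cantors_theorem [of "UNIV :: nat set"] by auto
  qed
  ultimately show "uncountable (range ?w)"
    using countable_image_inj_on by blast
  show "range ?w \<subseteq> {w. S_adic {sigma_morphism, mu_morphism} w}"
    using S_adic_digit_sum by blast
qed

end
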